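(* Let $\mathcal{G}$ be a connected metric graph with vertex set $\mathsf{V}$, edge set $\mathsf{E}$ and edge lengths $(\ell_{\mathsf{e}})_{\mathsf{e}\in\mathsf{E}}$, and let $\alpha\in[0,\infty)^{\mathsf{V}}$ be not identically zero. Let $t>0$ and let $\tilde{\mathcal{G}}$ be the metric graph obtained by scaling each edge of $\mathcal{G}$ by $t$, i.e. with edge lengths $\tilde{\ell}_{\mathsf{e}}=t\ell_{\mathsf{e}}$ for $\mathsf{e}\in\mathsf{E}$. Then $$t^{-3}\,T\!\left(\tilde{\mathcal{G}},\tfrac{1}{t}\alpha\right)=T(\mathcal{G},\alpha).$$
   Context: A metric graph $\mathcal{G}$ is a finite collection of intervals glued together at their endpoints according to a finite combinatorial graph $(\mathsf{V},\mathsf{E})$ (loops and multiple edges allowed); each edge $\mathsf{e}\in\mathsf{E}$ is identified with $[0,\ell_{\mathsf{e}}]$, $\ell_{\mathsf{e}}\in(0,\infty)$. It is connected if any two points are joined by a continuous path. $\mathsf{E}_{\mathsf{v}}$ is the collection of edges incident to $\mathsf{v}$ (a loop at $\mathsf{v}$ counted twice, once for each endpoint), $u_{\mathsf{e}}$ is the restriction of $u$ to $\mathsf{e}$, and $\frac{\partial u_{\mathsf{e}}}{\partial n}(\mathsf{v})$ is the derivative of $u_{\mathsf{e}}$ at the endpoint $\mathsf{v}$ in the direction pointing into $\mathsf{v}$. For $\alpha\in\mathbb{R}^{\mathsf{V}}$ (the strengths), the operator $-\Delta_{\mathcal{G},\alpha}$ in $L^2(\mathcal{G})$ acts as $u\mapsto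 -u''$ on each edge, on functions that are edgewise in $H^2(0,\ell_{\mathsf{e}})$, continuous at every vertex, and satisfy $\sum_{\mathsf{e}\in\mathsf{E}_{\mathsf{v}}}\frac{\partial u_{\mathsf{e}}}{\partial n}(\mathsf{v})+\alpha_{\mathsf{v}}u(\mathsf{v})=0$ for all $\mathsf{v}\in\mathsf{V}$. The torsion function of $(\mathcal{G},\alpha)$ is the unique solution $\upsilon$ of $-\Delta_{\mathcal{G},\alpha}\upsilon=1$ (it exists and is strictly positive when $\mathcal{G}$ is connected and $\alpha\in[0,\infty)^{\mathsf{V}}$ is not identically zero), and the torsional rigidity is $T(\mathcal{G},\alpha)=\int_{\mathcal{G}}\upsilon(x)\,\mathrm{d}x$. *)

theory Defs
  imports "HOL-Analysis.Analysis"
begin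

section \<open>Metric graphs\<close>

text \<open>
  Loops and multiple edges are allowed. The edge \<open>e\<close> is identified with the interval
  \<open>{0..len G e}\<close>, its point \<open>0\<close> being glued to \<open>src G e\<close> and its point \<open>len G e\<close> to
  \<open>tgt G e\<close>; the orientation only serves to fix this parametrisation.
\<close>

record ('v, 'e) mgraph =
  verts :: "'v set"
  edges :: "'e set"
  src :: "'e \<Rightarrow> 'v"
  tgt :: "'e \<Rightarrow> 'v"
  len :: "'e \<Rightarrow> real"

definition metric_graph :: "('v, 'e) mgraph \<Rightarrow> bool" where
  "metric_graph G \<longleftrightarrow>
     finite (verts G) \<and> finite (edges G) \<and>
     (\<forall>e\<in>edges G. src G e \<in> verts G \<and> tgt G e \<in> verts G \<and> 0 < len G e)"

definition scale_graph :: "real \<Rightarrow> ('v, 'e) mgraph \<Rightarrow> ('v, 'e) mgraph" where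
  "scale_graph t G = G\<lparr>len := (\<lambda>e. t * len G e)\<rparr>"

datatype ('v, 'e) gpoint = Vertex 'v | Interior 'e real

definition points :: "('v, 'e) mgraph \<Rightarrow> ('v, 'e) gpoint set" where
  "points G = Vertex ` verts G \<union> {Interior e x | e x. e \<in> edges G \<and> 0 < x \<and> x < len G e}"

definition edge_point :: "('v, 'e) mgraph \<Rightarrow> 'e \<Rightarrow> real \<Rightarrow> ('v, 'e) gpoint" where
  "edge_point G e x =
     (if x = 0 then Vertex (src G e) else if x = len G e then Vertex (tgt G e) else Interior e x)"

text \<open>
  The gluing (quotient) topology: the final topology for the maps
  \<open>edge_point G e\<close> from \<open>{0..len G e}\<close>.
\<close>

definition graph_topology :: "('v, 'e) mgraph \<Rightarrow> ('v, 'e) gpoint topology" where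
  "graph_topology G = topology (\<lambda>U. U \<subseteq> points G \<and>
     (\<forall>e\<in>edges G. openin (top_of_set {0..len G e}) {x \<in> {0..len G e}. edge_point G e x \<in> U}))"

lemma openin_graph_topology:
  "openin (graph_topology G) U \<longleftrightarrow> U \<subseteq> points G \<and>
     (\<forall>e\<in>edges G. openin (top_of_set {0..len G e}) {x \<in> {0..len G e}. edge_point G e x \<in> U})"
proof -
  let ?P = "\<lambda>e U. {x \<in> {0..len G e}. edge_point G e x \<in> U}"
  have "istopology (\<lambda>U. U \<subseteq> points G \<and> (\<forall>e\<in>edges G. openin (top_of_set {0..len G e}) (?P e U)))"
    unfolding istopology_def
  proof (intro conjI allI impI ballI)
    fix S T e
    assume S: "S \<subseteq> points G \<and> (\<forall>e\<in>edges G. openin (top_of_set {0..len G e}) (?P e S))"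
      and T: "T \<subseteq> points G \<and> (\<forall>e\<in>edges G. openin (top_of_set {0..len G e}) (?P e T))"
      and e: "e \<in> edges G"
    have "?P e (S \<inter> T) = ?P e S \<inter> ?P e T" by auto
    then show "openin (top_of_set {0..len G e}) (?P e (S \<inter> T))"
      using S T e by (simp add: openin_Int)
  next
    fix K e
    assume K: "\<forall>S\<in>K. S \<subseteq> points G \<and> (\<forall>e\<in>edges G. openin (top_of_set {0..len G e}) (?P e S))"
      and e: "e \<in> edges G"
    have "?P e (\<Union>K) = \<Union> (?P e ` K)" by auto
    moreover have "openin (top_of_set {0..len G e}) (\<Union> (?P e ` K))"
      using K e by (intro openin_Union) auto
    ultimately show "openin (top_of_set {0..len G e}) (?P e (\<Union>K))" by simp
  qed auto
  then show ?thesis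
    unfolding graph_topology_def by (simp add: topology_inverse')
qed

lemma topspace_graph_topology:
  assumes "metric_graph G"
  shows "topspace (graph_topology G) = points G"
proof -
  have "edge_point G e x \<in> points G" if "e \<in> edges G" "x \<in> {0..len G e}" for e x
    using that assms by (auto simp: edge_point_def points_def metric_graph_def)
  then have "{x \<in> {0..len G e}. edge_point G e x \<in> points G} = {0..len G e}"
    if "e \<in> edges G" for e
    using that by blast
  then have "openin (graph_topology G) (points G)"
    by (auto simp: openin_graph_topology)
  then show ?thesis
    by (meson openin_graph_topology openin_subset openin_topspace subset_antisym)
qed

definition connected_graph :: "('v, 'e) mgraph \<Rightarrow> bool" where
  "connected_graph G \<longleftrightarrow> path_connected_space (graph_topology G)"


section \<open>The Sobolev space \<open>H\<^sup>2(a,b)\<close>\<close>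

definition L2 :: "real \<Rightarrow> real \<Rightarrow> (real \<Rightarrow> real) set" where
  "L2 a b = {f. f \<in> borel_measurable (lebesgue_on {a<..<b}) \<and>
                integrable (lebesgue_on {a<..<b}) (\<lambda>x. (f x)\<^sup>2)}"

text \<open>Test functions are of class \<open>C\<^sup>1\<close> with compact support in the open interval.\<close>

definition test_functions :: "real \<Rightarrow> real \<Rightarrow> (real \<Rightarrow> real) set" where
  "test_functions a b = {\<phi>. (\<forall>x. \<phi> differentiable (at x)) \<and> continuous_on UNIV (deriv \<phi>) \<and>
     compact (closure {x. \<phi> x \<noteq> 0}) \<and> closure {x. \<phi> x \<noteq> 0} \<subseteq> {a<..<b}}"

definition weak_derivative :: "real \<Rightarrow> real \<Rightarrow> (real \<Rightarrow> real) \<Rightarrow> (real \<Rightarrow> real) \<Rightarrow> bool" where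
  "weak_derivative a b f g \<longleftrightarrow> (\<forall>\<phi>\<in>test_functions a b.
     (LINT x|lebesgue_on {a<..<b}. f x * deriv \<phi> x) = - (LINT x|lebesgue_on {a<..<b}. g x * \<phi> x))"

definition second_weak_derivative :: "real \<Rightarrow> real \<Rightarrow> (real \<Rightarrow> real) \<Rightarrow> (real \<Rightarrow> real) \<Rightarrow> bool" where
  "second_weak_derivative a b f h \<longleftrightarrow> (\<exists>g\<in>L2 a b. weak_derivative a b f g \<and> weak_derivative a b g h)"

definition H2 :: "real \<Rightarrow> real \<Rightarrow> (real \<Rightarrow> real) set" where
  "H2 a b = {f \<in> L2 a b. \<exists>h\<in>L2 a b. second_weak_derivative a b f h}"


section \<open>The Laplacian with strengths \<open>\<alpha>\<close>, torsion function and torsional rigidity\<close>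

definition restr :: "('v, 'e) mgraph \<Rightarrow> (('v, 'e) gpoint \<Rightarrow> real) \<Rightarrow> 'e \<Rightarrow> real \<Rightarrow> real" where
  "restr G u e x = u (edge_point G e x)"

text \<open>
  Sum over \<open>E\<^sub>v\<close> of the derivatives of \<open>u\<^sub>e\<close> at \<open>v\<close> pointing into \<open>v\<close>; a loop at \<open>v\<close> occurs
  in both sums. At the end \<open>0\<close> the direction into the vertex is the negative one.
\<close>

definition normal_derivative_sum ::
    "('v, 'e) mgraph \<Rightarrow> (('v, 'e) gpoint \<Rightarrow> real) \<Rightarrow> 'v \<Rightarrow> real" where
  "normal_derivative_sum G u v =
     (\<Sum>e | e \<in> edges G \<and> src G e = v.
        - vector_derivative (restr G u e) (at 0 within {0..len G e})) +
     (\<Sum>e | e \<in> edges G \<and> tgt G e = v.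
        vector_derivative (restr G u e) (at (len G e) within {0..len G e}))"

text \<open>
  An element of the domain is given by its continuous representative, a function on
  \<open>points G\<close>. Functions in \<open>H\<^sup>2(0, len G e)\<close> have one that is continuous (even \<open>C\<^sup>1\<close>) up to the
  end points of the edge, so for it continuity at the vertices amounts to continuity on
  the whole graph. Being \<open>extensional\<close> (i.e. \<open>undefined\<close> off \<open>points G\<close>) makes HOL equality
  of such functions coincide with equality on the graph.
\<close>

definition laplacian_domain ::
    "('v, 'e) mgraph \<Rightarrow> ('v \<Rightarrow> real) \<Rightarrow> (('v, 'e) gpoint \<Rightarrow> real) set" where
  "laplacian_domain G \<alpha> = {u \<in> extensional (points G).
     (\<forall>e\<in>edges G. restr G u e \<in> H2 0 (len G e)) \<and>
     continuous_map (graph_topology G) euclideanreal u \<and>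
     (\<forall>v\<in>verts G. normal_derivative_sum G u v + \<alpha> v * u (Vertex v) = 0)}"

text \<open>
  \<open>neg_laplacian G \<alpha> u f\<close> says that the operator maps \<open>u\<close> to \<open>f\<close>, i.e. \<open>- u'' = f\<close> on each
  edge, for \<open>f\<close> square integrable on the graph.
\<close>

definition neg_laplacian ::
    "('v, 'e) mgraph \<Rightarrow> ('v \<Rightarrow> real) \<Rightarrow> (('v, 'e) gpoint \<Rightarrow> real) \<Rightarrow> (('v, 'e) gpoint \<Rightarrow> real) \<Rightarrow> bool" where
  "neg_laplacian G \<alpha> u f \<longleftrightarrow> u \<in> laplacian_domain G \<alpha> \<and>
     (\<forall>e\<in>edges G. restr G f e \<in> L2 0 (len G e) \<and>
        second_weak_derivative 0 (len G e) (restr G u e) (\<lambda>x. - restr G f e x))"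

definition torsion_function :: "('v, 'e) mgraph \<Rightarrow> ('v \<Rightarrow> real) \<Rightarrow> ('v, 'e) gpoint \<Rightarrow> real" where
  "torsion_function G \<alpha> = (THE u. neg_laplacian G \<alpha> u (\<lambda>_. 1))"

definition torsional_rigidity :: "('v, 'e) mgraph \<Rightarrow> ('v \<Rightarrow> real) \<Rightarrow> real" where
  "torsional_rigidity G \<alpha> =
     (\<Sum>e\<in>edges G. LINT x|lebesgue_on {0..len G e}. restr G (torsion_function G \<alpha>) e x)"

end

theory Submission
  imports Defs
begin

text \<open>
  The torsion function is a quadratic polynomial with leading coefficient \<open>- 1/2\<close> on each edge, so it is
  determined by its vertex values \<open>w\<close>, which solve a linear system: a weighted graph Laplacian plus the
  diagonal matrix \<open>\<alpha>\<close>, with the half lengths of the incident edges as right-hand side. Its energy form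
  is positive definite since the graph is connected and \<open>\<alpha>\<close> is nonnegative and not zero, so \<open>w\<close>
  exists and is unique, and the rigidity is
  \<open>\<Sum>e. len e * (w (src e) + w (tgt e)) / 2 + len e ^ 3 / 12\<close>. Scaling turns \<open>w\<close> into \<open>t\<^sup>2 * w\<close>.
\<close>

section \<open>Weak derivatives on an interval\<close>

lemma
  fixes f :: "real \<Rightarrow> real"
  assumes "continuous_on {a..b} f"
  shows integrable_lebesgue_on_Ioo: "integrable (lebesgue_on {a<..<b}) f"
    and integral_lebesgue_on_Ioo: "(LINT x|lebesgue_on {a<..<b}. f x) = integral {a..b} f"
proof -
  have "f absolutely_integrable_on {a<..<b}"
    by (rule set_integrable_subset[OF absolutely_integrable_continuous_real[OF assms]]) auto
  then show i: "integrable (lebesgue_on {a<..<b}) f"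
    by (rule absolutely_integrable_imp_integrable) auto
  show "(LINT x|lebesgue_on {a<..<b}. f x) = integral {a..b} f"
    by (subst lebesgue_integral_eq_integral[OF i]) (auto simp: integral_open_interval_real)
qed

lemma L2_continuous:
  assumes "continuous_on {a..b} f"
  shows "f \<in> L2 a b"
  unfolding L2_def using assms
  by (auto intro!: integrable_lebesgue_on_Ioo borel_measurable_integrable continuous_intros)

lemma deriv_test_function:
  assumes "\<phi> \<in> test_functions a b"
  shows "(\<phi> has_real_derivative deriv \<phi> x) (at x)"
  using assms by (auto simp: test_functions_def DERIV_deriv_iff_real_differentiable)

lemma test_function_eq_0:
  assumes "\<phi> \<in> test_functions a b" "x \<notin> {a<..<b}"
  shows "\<phi> x = 0"
  using assms closure_subset[of "{x. \<phi> x \<noteq> 0}"] by (auto simp: test_functions_def)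

text \<open>Integration by parts; the boundary terms drop out because a test function vanishes at
  both end points. One-sided derivatives at \<open>a\<close> and \<open>b\<close> suffice, which is
  what functions on a closed edge provide.\<close>

lemma weak_derivative_C1:
  fixes f g :: "real \<Rightarrow> real"
  assumes "\<And>x. x \<in> {a..b} \<Longrightarrow> (f has_real_derivative g x) (at x within {a..b})"
    and "continuous_on {a..b} g" "a \<le> b"
  shows "weak_derivative a b f g"
  unfolding weak_derivative_def
proof
  fix \<phi> assume \<phi>: "\<phi> \<in> test_functions a b"
  have cf: "continuous_on {a..b} f"
    using assms(1) by (meson DERIV_continuous continuous_on_eq_continuous_within)
  have cd: "continuous_on {a..b} (deriv \<phi>)"
    using \<phi> continuous_on_subset by (auto simp: test_functions_def)
  have cp: "continuous_on {a..b} \<phi>"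
    using deriv_test_function[OF \<phi>] by (meson DERIV_continuous continuous_at_imp_continuous_on)
  have "((\<lambda>x. f x * deriv \<phi> x + g x * \<phi> x) has_integral f b * \<phi> b - f a * \<phi> a) {a..b}"
  proof (rule fundamental_theorem_of_calculus[OF assms(3)])
    fix x assume "x \<in> {a..b}"
    then show "((\<lambda>x. f x * \<phi> x) has_vector_derivative f x * deriv \<phi> x + g x * \<phi> x) (at x within {a..b})"
      unfolding has_real_derivative_iff_has_vector_derivative[symmetric]
      using assms(1) has_field_derivative_at_within[OF deriv_test_function[OF \<phi>]]
      by (auto intro!: derivative_eq_intros)
  qed
  then have "integral {a..b} (\<lambda>x. f x * deriv \<phi> x + g x * \<phi> x) = 0"
    using test_function_eq_0[OF \<phi>] by (simp add: integral_unique)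
  moreover have "integral {a..b} (\<lambda>x. f x * deriv \<phi> x + g x * \<phi> x) =
      integral {a..b} (\<lambda>x. f x * deriv \<phi> x) + integral {a..b} (\<lambda>x. g x * \<phi> x)"
    by (rule integral_add) (auto intro!: integrable_continuous_real continuous_intros cf cd cp assms)
  ultimately show "(LINT x|lebesgue_on {a<..<b}. f x * deriv \<phi> x) =
      - (LINT x|lebesgue_on {a<..<b}. g x * \<phi> x)"
    using integral_lebesgue_on_Ioo[OF continuous_on_mult[OF cf cd]]
      integral_lebesgue_on_Ioo[OF continuous_on_mult[OF assms(2) cp]] by simp
qed

section \<open>Regularity: continuous weak solutions of -u'' = 1 on an interval are
  quadratic\<close>

lemma second_weak_derivative_test:
  assumes "second_weak_derivative a b f h" "\<phi> \<in> test_functions a b" "deriv \<phi> \<in> test_functions a b"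
  shows "(LINT x|lebesgue_on {a<..<b}. f x * deriv (deriv \<phi>) x) =
    (LINT x|lebesgue_on {a<..<b}. h x * \<phi> x)"
proof -
  obtain g where g: "weak_derivative a b f g" "weak_derivative a b g h"
    using assms(1) by (auto simp: second_weak_derivative_def)
  \<comment> \<open>The intermediate derivative \<open>g\<close> cancels: the first weak derivative
    is tested with \<open>deriv \<phi>\<close>, the second with \<open>\<phi>\<close>.\<close>
  show ?thesis
    using bspec[OF g(1)[unfolded weak_derivative_def] assms(3)]
      bspec[OF g(2)[unfolded weak_derivative_def] assms(2)] by linarith
qed

text \<open>The primitive normalised to vanish at \<open>c\<close> also vanishes at \<open>d\<close>
  since the mean of \<open>\<psi>\<close> is zero, and it is constant on either side of the support.
  Applying this twice inverts the second derivative among compactly supported functions.\<close>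

lemma compactly_supported_primitive:
  fixes \<psi> :: "real \<Rightarrow> real"
  assumes cont: "continuous_on UNIV \<psi>" and supp: "\<And>x. x \<notin> {c..d} \<Longrightarrow> \<psi> x = 0"
    and "c < d" and int: "integral {c..d} \<psi> = 0"
  obtains F where "\<And>x. (F has_real_derivative \<psi> x) (at x)" "\<And>x. x \<notin> {c<..<d} \<Longrightarrow> F x = 0"
proof -
  have "\<exists>F. \<forall>x::real. -\<infinity> < ereal x \<longrightarrow> ereal x < \<infinity> \<longrightarrow> (F has_vector_derivative \<psi> x) (at x)"
    by (rule einterval_antiderivative) (use cont in \<open>auto simp: continuous_on_eq_continuous_at\<close>)
  then obtain F0 where "\<And>x. (F0 has_real_derivative \<psi> x) (at x)"
    by (auto simp: has_real_derivative_iff_has_vector_derivative)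
  then have F: "((\<lambda>x. F0 x - F0 c) has_real_derivative \<psi> x) (at x)" for x
    by (auto intro!: derivative_eq_intros)
  define F where "F x = F0 x - F0 c" for x
  have D: "(F has_real_derivative \<psi> x) (at x)" for x
    using F[of x] unfolding F_def .
  have Fint: "(\<psi> has_integral F y - F x) {x..y}" if "x \<le> y" for x y
    using that D
    by (intro fundamental_theorem_of_calculus)
       (auto simp: has_real_derivative_iff_has_vector_derivative intro: has_vector_derivative_at_within)
  have Fc: "F c = 0" by (simp add: F_def)
  have Fd: "F d = 0" using Fint[of c d] int \<open>c < d\<close> Fc by (simp add: integral_unique)
  \<comment> \<open>\<open>F\<close> is constant across any gap of \<open>\<psi>\<close>; values of
    \<open>\<psi>\<close> at the ends of the gap do not enter, so \<open>c\<close> and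
    \<open>d\<close> themselves may be such ends.\<close>
  have *: "F x = F y" if "x \<le> y" "\<And>z. x < z \<Longrightarrow> z < y \<Longrightarrow> \<psi> z = 0" for x y
  proof -
    have "(\<psi> has_integral 0) {x<..<y}"
      by (rule has_integral_is_0) (use that in auto)
    then have "F y - F x = 0"
      by (rule has_integral_unique[OF Fint[OF that(1), unfolded has_integral_Icc_iff_Ioo]])
    then show ?thesis by simp
  qed
  show ?thesis
  proof (rule that[of F])
    show "F x = 0" if "x \<notin> {c<..<d}" for x
    proof (cases "x \<le> c")
      case True then show ?thesis using *[of x c] supp Fc by auto
    next
      case False then show ?thesis using *[of d x] that supp Fd by auto
    qed
  qed (rule D)
qed

lemma test_functionI:
  assumes D: "\<And>x. (\<phi> has_real_derivative \<phi>' x) (at x)" and cont: "continuous_on UNIV \<phi>'"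
    and supp: "\<And>x. x \<notin> {c..d} \<Longrightarrow> \<phi> x = 0" and "a < c" "d < b"
  shows "\<phi> \<in> test_functions a b" "deriv \<phi> = \<phi>'"
proof -
  show d: "deriv \<phi> = \<phi>'" using D by (auto intro: DERIV_imp_deriv)
  have "{x. \<phi> x \<noteq> 0} \<subseteq> {c..d}" using supp by blast
  then have "closure {x. \<phi> x \<noteq> 0} \<subseteq> {c..d}" by (rule closure_minimal) simp
  moreover from this have "compact (closure {x. \<phi> x \<noteq> 0})"
    by (meson bounded_closed_interval bounded_subset closed_closure compact_eq_bounded_closed)
  ultimately show "\<phi> \<in> test_functions a b"
    using D cont d \<open>a < c\<close> \<open>d < b\<close>
    by (auto simp: test_functions_def real_differentiable_def)
qed

text \<open>The two moment conditions say that \<open>\<psi>\<close> is the second derivative of a function supported in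
  \<open>{c..d}\<close>. The proof tests \<open>p\<close> against \<open>\<rho> * q\<close>, where \<open>q\<close> is the remainder of \<open>p\<close> after projection onto
  the affine functions in the weighted inner product \<open>\<integral> \<rho> f g\<close>; the weight \<open>\<rho>\<close> vanishes at the end
  points, so that \<open>\<rho> * q\<close> can be extended continuously by zero. Then \<open>\<integral> \<rho> q\<^sup>2 = 0\<close>.\<close>

lemma affine_if_orthogonal_to_second_derivatives:
  fixes p :: "real \<Rightarrow> real"
  assumes cont: "continuous_on {c..d} p" and "c < d"
    and orth: "\<And>\<psi>. continuous_on UNIV \<psi> \<Longrightarrow> (\<And>x. x \<notin> {c..d} \<Longrightarrow> \<psi> x = 0) \<Longrightarrow>
      integral {c..d} \<psi> = 0 \<Longrightarrow> integral {c..d} (\<lambda>x. x * \<psi> x) = 0 \<Longrightarrow>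
      integral {c..d} (\<lambda>x. p x * \<psi> x) = 0"
  obtains A B where "\<And>x. x \<in> {c<..<d} \<Longrightarrow> p x = A + B * x"
proof -
  define \<rho> where "\<rho> x = (x - c) * (d - x)" for x :: real
  have crho: "continuous_on S \<rho>" for S unfolding \<rho>_def by (intro continuous_intros)
  have pos: "\<rho> x > 0" if "x \<in> {c<..<d}" for x using that by (simp add: \<rho>_def)
  have nonneg: "\<rho> x \<ge> 0" if "x \<in> {c..d}" for x using that by (simp add: \<rho>_def)
  let ?I = "\<lambda>f. integral {c..d} (\<lambda>x. \<rho> x * f x)"
  have intg: "(\<lambda>x. \<rho> x * f x) integrable_on {c..d}" if "continuous_on {c..d} f" for f
    by (intro integrable_continuous_real continuous_intros crho that)
  \<comment> \<open>Definiteness of the weighted inner product; only interior points are reached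
    because the weight is zero at \<open>c\<close> and \<open>d\<close>.\<close>
  have sq: "f x = 0" if "continuous_on {c..d} f" "?I (\<lambda>x. f x * f x) = 0" "x \<in> {c<..<d}" for f x
  proof -
    have "\<forall>x\<in>{c..d}. \<rho> x * (f x * f x) = 0"
      using that(2) nonneg
      by (subst (asm) integral_eq_0_iff) (auto intro!: continuous_intros crho that \<open>c < d\<close>)
    then show ?thesis using pos[OF that(3)] that(3) by (force)
  qed
  have I_comb: "?I (\<lambda>x. f x - k * g x) = ?I f - k * ?I g"
    if "continuous_on {c..d} f" "continuous_on {c..d} g" for f g k
  proof -
    have "?I (\<lambda>x. f x - k * g x) = integral {c..d} (\<lambda>x. \<rho> x * f x - k * (\<rho> x * g x))"
      by (simp add: algebra_simps)
    also have "\<dots> = ?I f - k * ?I g"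
      by (subst integral_diff) (auto intro!: intg that integrable_on_mult_right)
    finally show ?thesis .
  qed
  \<comment> \<open>Two distinct interior points: one shows that the constant 1 has nonzero norm,
    both together that the nonconstant affine function \<open>l\<close> does.\<close>
  obtain z where z: "c < z" "z < d" using dense[OF \<open>c < d\<close>] by blast
  obtain z' where z': "z < z'" "z' < d" using dense[OF z(2)] by blast
  have one: "?I (\<lambda>_. 1) \<noteq> 0" using sq[of "\<lambda>_. 1" z] z by auto
  \<comment> \<open>Gram-Schmidt: \<open>m\<close> is the weighted mean of \<open>x\<close>, so
    \<open>l\<close> is orthogonal to 1, and 1 and \<open>l\<close> form an orthogonal basis of the
    affine functions.\<close>
  define m where "m = ?I (\<lambda>x. x) / ?I (\<lambda>_. 1)"
  define l where "l x = x - m" for x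
  have cl: "continuous_on S l" for S unfolding l_def by (intro continuous_intros)
  have "?I (\<lambda>x. l x * l x) \<noteq> 0"
  proof
    assume "?I (\<lambda>x. l x * l x) = 0"
    then have "l z = 0" "l z' = 0" using sq[OF cl, of z] sq[OF cl, of z'] z z' by auto
    then show False using z' by (simp add: l_def)
  qed
  note two = this
  have l0: "?I l = 0"
    using I_comb[of "\<lambda>x. x" "\<lambda>_. 1" m] one by (simp add: l_def m_def continuous_intros)
  define \<beta> where "\<beta> = ?I (\<lambda>x. p x * l x) / ?I (\<lambda>x. l x * l x)"
  define \<alpha> where "\<alpha> = ?I p / ?I (\<lambda>_. 1)"
  \<comment> \<open>Here \<open>\<alpha>\<close> and \<open>\<beta>\<close> are the projection
    coefficients of \<open>p\<close>. The factor 1 keeps the shape that \<open>I_comb\<close>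
    rewrites.\<close>
  define q where "q x = p x - \<beta> * l x - \<alpha> * 1" for x
  have cq: "continuous_on {c..d} q" unfolding q_def by (intro continuous_intros cont cl)
  have q0: "?I q = 0"
  proof -
    have "?I q = ?I p - \<beta> * ?I l - \<alpha> * ?I (\<lambda>_. 1)"
      unfolding q_def by (subst I_comb I_comb; (intro continuous_intros cont cl)?)+ simp
    then show ?thesis using l0 one by (simp add: \<alpha>_def)
  qed
  have ql: "?I (\<lambda>x. q x * l x) = 0"
  proof -
    have "?I (\<lambda>x. q x * l x) = ?I (\<lambda>x. (p x * l x - \<beta> * (l x * l x)) - \<alpha> * l x)"
      by (simp add: q_def algebra_simps)
    also have "\<dots> = ?I (\<lambda>x. p x * l x) - \<beta> * ?I (\<lambda>x. l x * l x) - \<alpha> * ?I l"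
      by (subst I_comb I_comb; (intro continuous_intros cont cl)?)+ simp
    finally show ?thesis using l0 two by (simp add: \<beta>_def)
  qed
  \<comment> \<open>Outside \<open>{c..d}\<close> the weight is not positive, so the maximum cuts it
    off to zero; clamping the argument keeps \<open>q\<close> on the interval where it is known to
    be continuous.\<close>
  define \<psi> where "\<psi> x = max 0 (\<rho> x) * q (max c (min d x))" for x
  have \<psi>_eq: "\<psi> x = \<rho> x * q x" if "x \<in> {c..d}" for x
    using that nonneg[OF that] by (simp add: \<psi>_def max_absorb2 min_absorb2)
  have "integral {c..d} (\<lambda>x. p x * \<psi> x) = 0"
  proof (rule orth)
    have "continuous_on UNIV (q \<circ> (\<lambda>x. max c (min d x)))"
      using \<open>c < d\<close> by (intro continuous_on_compose continuous_intros continuous_on_subset[OF cq]) auto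
    then show "continuous_on UNIV \<psi>"
      unfolding \<psi>_def o_def by (intro continuous_intros crho)
    show "\<psi> x = 0" if "x \<notin> {c..d}" for x
    proof -
      have "\<rho> x \<le> 0"
        using that \<open>c < d\<close> unfolding \<rho>_def by (auto simp: mult_le_0_iff)
      then show ?thesis by (simp add: \<psi>_def)
    qed
    show "integral {c..d} \<psi> = 0"
      using q0 \<psi>_eq integral_cong[of "{c..d}" \<psi> "\<lambda>x. \<rho> x * q x"] by auto
    \<comment> \<open>Uses x = \<open>l x\<close> + \<open>m\<close>, with the sum written as a
      difference to fit \<open>I_comb\<close>.\<close>
    have "integral {c..d} (\<lambda>x. x * \<psi> x) = ?I (\<lambda>x. q x * l x - (- m) * q x)"
      by (rule integral_cong) (simp add: \<psi>_eq l_def algebra_simps)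
    also have "\<dots> = 0"
      by (subst I_comb) (auto intro!: continuous_intros cq cl simp: q0 ql)
    finally show "integral {c..d} (\<lambda>x. x * \<psi> x) = 0" .
  qed
  also have "integral {c..d} (\<lambda>x. p x * \<psi> x) = ?I (\<lambda>x. p x * q x)"
    by (rule integral_cong) (simp add: \<psi>_eq algebra_simps)
  finally have pq: "?I (\<lambda>x. p x * q x) = 0" .
  have "?I (\<lambda>x. q x * q x) = ?I (\<lambda>x. (p x * q x - \<beta> * (q x * l x)) - \<alpha> * q x)"
    by (simp add: q_def algebra_simps)
  also have "\<dots> = 0"
    by (subst I_comb I_comb; (intro continuous_intros cont cl cq)?)+ (simp add: pq ql q0)
  finally have "q x = 0" if "x \<in> {c<..<d}" for x using sq[OF cq] that by blast
  then have "p x = (\<alpha> - \<beta> * m) + \<beta> * x" if "x \<in> {c<..<d}" for x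
    using that by (simp add: q_def l_def algebra_simps)
  then show ?thesis using that by blast
qed

text \<open>The function -x^2/2 has the same second weak derivative as \<open>u\<close>, so
  \<open>u x + x\<^sup>2 / 2\<close> integrates to zero against second derivatives of test functions
  and is affine. The strictly smaller interval \<open>{c..d}\<close> keeps the supports compact in
  the open interval.\<close>

lemma second_weak_derivative_minus_1_locally:
  assumes cont: "continuous_on {a..b} u"
    and weak: "second_weak_derivative a b u (\<lambda>_. - 1)" and "a < c" "c < d" "d < b"
  obtains A B where "\<And>x. x \<in> {c<..<d} \<Longrightarrow> u x + x\<^sup>2 / 2 = A + B * x"
proof (rule affine_if_orthogonal_to_second_derivatives[of c d "\<lambda>x. u x + x\<^sup>2 / 2"])
  have sub: "{c..d} \<subseteq> {a..b}" using assms by auto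
  show "continuous_on {c..d} (\<lambda>x. u x + x\<^sup>2 / 2)"
    by (intro continuous_intros continuous_on_subset[OF cont sub]) simp
  fix \<psi> :: "real \<Rightarrow> real"
  assume \<psi>: "continuous_on UNIV \<psi>" "\<And>x. x \<notin> {c..d} \<Longrightarrow> \<psi> x = 0"
    and int: "integral {c..d} \<psi> = 0" "integral {c..d} (\<lambda>x. x * \<psi> x) = 0"
  obtain F where F: "\<And>x. (F has_real_derivative \<psi> x) (at x)" "\<And>x. x \<notin> {c<..<d} \<Longrightarrow> F x = 0"
    using compactly_supported_primitive[OF \<psi> \<open>c < d\<close> int(1)] by blast
  have cF: "continuous_on UNIV F"
    using F(1) by (meson DERIV_continuous continuous_at_imp_continuous_on)
  \<comment> \<open>Integrating the derivative of x * \<open>F x\<close> turns the vanishing first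
    moment of \<open>\<psi>\<close> into a vanishing mean of \<open>F\<close>, as the second
    primitive \<open>\<phi>\<close> requires.\<close>
  have "((\<lambda>x. F x + x * \<psi> x) has_integral d * F d - c * F c) {c..d}"
  proof (rule fundamental_theorem_of_calculus)
    fix x
    have "((\<lambda>x. x * F x) has_real_derivative F x + x * \<psi> x) (at x)"
      using F(1)[of x] by (auto intro!: derivative_eq_intros)
    then show "((\<lambda>x. x * F x) has_vector_derivative F x + x * \<psi> x) (at x within {c..d})"
      by (simp add: has_real_derivative_iff_has_vector_derivative has_vector_derivative_at_within)
  qed (use \<open>c < d\<close> in simp)
  then have "integral {c..d} (\<lambda>x. F x + x * \<psi> x) = 0"
    using F(2)[of c] F(2)[of d] by (simp add: integral_unique)
  moreover have "integral {c..d} (\<lambda>x. F x + x * \<psi> x) = integral {c..d} F + integral {c..d} (\<lambda>x. x * \<psi> x)"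
    by (rule integral_add)
       (auto intro!: integrable_continuous_real continuous_intros continuous_on_subset[OF cF] continuous_on_subset[OF \<psi>(1)])
  ultimately have "integral {c..d} F = 0" using int by simp
  moreover have "F x = 0" if "x \<notin> {c..d}" for x using that by (intro F(2)) auto
  ultimately obtain \<phi> where
    \<phi>: "\<And>x. (\<phi> has_real_derivative F x) (at x)" "\<And>x. x \<notin> {c<..<d} \<Longrightarrow> \<phi> x = 0"
    using compactly_supported_primitive[OF cF _ \<open>c < d\<close>] by blast
  have tF: "F \<in> test_functions a b" "deriv F = \<psi>"
    by (rule test_functionI[OF F(1) \<psi>(1), of c d a b]; (rule F(2))?; use assms in auto)+
  have tphi: "\<phi> \<in> test_functions a b" "deriv \<phi> = F"
    by (rule test_functionI[OF \<phi>(1) cF, of c d a b]; (rule \<phi>(2))?; use assms in auto)+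
  have weak2: "second_weak_derivative a b (\<lambda>x. - (x\<^sup>2 / 2)) (\<lambda>_. - 1)"
    unfolding second_weak_derivative_def
  proof (intro bexI conjI)
    show "weak_derivative a b (\<lambda>x. - (x\<^sup>2 / 2)) (\<lambda>x. - x)"
      by (rule weak_derivative_C1) (use assms in \<open>auto intro!: derivative_eq_intros continuous_intros\<close>)
    show "weak_derivative a b (\<lambda>x. - x) (\<lambda>x. - 1)"
      by (rule weak_derivative_C1) (use assms in \<open>auto intro!: derivative_eq_intros continuous_intros\<close>)
  qed (intro L2_continuous continuous_intros)
  have cu\<psi>: "continuous_on {a..b} (\<lambda>x. u x * \<psi> x)"
    by (intro continuous_intros cont continuous_on_subset[OF \<psi>(1)]) simp
  have cx\<psi>: "continuous_on {a..b} (\<lambda>x. - (x\<^sup>2 / 2) * \<psi> x)"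
    by (intro continuous_intros continuous_on_subset[OF \<psi>(1)]) simp_all
  have "(LINT x|lebesgue_on {a<..<b}. u x * \<psi> x) = (LINT x|lebesgue_on {a<..<b}. - (x\<^sup>2 / 2) * \<psi> x)"
    using second_weak_derivative_test[OF weak tphi(1)] second_weak_derivative_test[OF weak2 tphi(1)] tF tphi
    by simp
  then have "integral {a..b} (\<lambda>x. u x * \<psi> x) = integral {a..b} (\<lambda>x. - (x\<^sup>2 / 2) * \<psi> x)"
    using integral_lebesgue_on_Ioo[OF cu\<psi>] integral_lebesgue_on_Ioo[OF cx\<psi>] by simp
  then have "0 = integral {a..b} (\<lambda>x. u x * \<psi> x - - (x\<^sup>2 / 2) * \<psi> x)"
    using integral_diff[OF integrable_continuous_real[OF cu\<psi>] integrable_continuous_real[OF cx\<psi>]] by simp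
  also have "\<dots> = integral {a..b} (\<lambda>x. (u x + x\<^sup>2 / 2) * \<psi> x)"
    by (simp add: algebra_simps)
  also have "\<dots> = integral {c..d} (\<lambda>x. (u x + x\<^sup>2 / 2) * \<psi> x)"
    by (rule integral_unique, rule has_integral_on_superset[OF integrable_integral])
       (use sub \<psi> in \<open>auto intro!: integrable_continuous_real continuous_intros
          intro: continuous_on_subset[OF cont sub] continuous_on_subset[OF \<psi>(1)]\<close>)
  finally show "integral {c..d} (\<lambda>x. (u x + x\<^sup>2 / 2) * \<psi> x) = 0" by simp
qed (use assms in auto)

text \<open>The local affine pieces agree because all of them are read off at the same two anchors
  \<open>b / 2\<close> and \<open>b / 4\<close>; continuity then carries the formula to the end
  points.\<close>

lemma second_weak_derivative_minus_1:
  assumes cont: "continuous_on {0..b} u"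
    and weak: "second_weak_derivative 0 b u (\<lambda>_. - 1)" and "0 < b" and x: "x \<in> {0..b}"
  shows "u x = u 0 * (1 - x / b) + u b * (x / b) + x * (b - x) / 2"
proof -
  define p where "p x = u x + x\<^sup>2 / 2" for x
  have cp: "continuous_on {0..b} p" unfolding p_def by (intro continuous_intros cont) simp
  \<comment> \<open>Collinearity with the two anchors. The choice of \<open>c\<close> and
    \<open>d\<close> places \<open>x\<close> and both anchors strictly inside an interval that stays
    away from 0 and \<open>b\<close>.\<close>
  have coll: "(p x - p (b / 2)) * (b / 4) = (p (b / 2) - p (b / 4)) * (x - b / 2)"
    if "x \<in> {0<..<b}" for x
  proof -
    define c where "c = min x (b / 4) / 2"
    define d where "d = (max x (b / 2) + b) / 2"
    have cd: "0 < c" "c < d" "d < b" "x \<in> {c<..<d}" "b / 2 \<in> {c<..<d}" "b / 4 \<in> {c<..<d}"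
      using that \<open>0 < b\<close> by (auto simp: c_def d_def min_def max_def)
    obtain A B where *: "\<And>y. y \<in> {c<..<d} \<Longrightarrow> p y = A + B * y"
      using second_weak_derivative_minus_1_locally[OF cont weak cd(1-3)] unfolding p_def by blast
    have "p x = A + B * x" "p (b / 2) = A + B * (b / 2)" "p (b / 4) = A + B * (b / 4)"
      using * cd(4-6) by blast+
    then show ?thesis by (simp add: algebra_simps)
  qed
  have cl: "closure {0<..<b} = {0..b}" using \<open>0 < b\<close> by simp
  have coll': "(p x - p (b / 2)) * (b / 4) - (p (b / 2) - p (b / 4)) * (x - b / 2) = 0"
    if "x \<in> {0..b}" for x
    by (rule continuous_constant_on_closure[of "{0<..<b}"])
       (use that coll \<open>0 < b\<close> in \<open>auto simp: cl intro!: continuous_intros cp\<close>)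
  define B where "B = (p (b / 2) - p (b / 4)) / (b / 4)"
  have p: "p x = p (b / 2) + B * (x - b / 2)" if "x \<in> {0..b}" for x
    using coll'[OF that] \<open>0 < b\<close> by (simp add: B_def field_simps)
  have eq: "p x = p 0 * (1 - x / b) + p b * (x / b)"
  proof -
    define P where "P = p (b / 2)"
    have *: "p x = P + B * (x - b / 2)" "p 0 = P + B * (0 - b / 2)" "p b = P + B * (b - b / 2)"
      using p[OF x] p[of 0] p[of b] \<open>0 < b\<close> by (auto simp: P_def)
    show ?thesis unfolding * using \<open>0 < b\<close> by (simp add: field_simps)
  qed
  have *: "u x = p x - x\<^sup>2 / 2" "u 0 = p 0" "u b = p b - b\<^sup>2 / 2"
    by (simp_all add: p_def)
  show ?thesis unfolding * eq using \<open>0 < b\<close> by (simp add: field_simps power2_eq_square)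
qed

section \<open>Square linear systems\<close>

text \<open>Gaussian elimination by induction on the unknowns. Rows and columns have separate index
  sets, since a step deletes a pivot row \<open>i0\<close> and an unrelated column
  \<open>k\<close>.\<close>

lemma square_system_solvable:
  fixes A :: "'i \<Rightarrow> 'j \<Rightarrow> real"
  assumes "finite J" "finite I" "card I = card J"
    and "\<And>w. (\<And>i. i \<in> I \<Longrightarrow> (\<Sum>j\<in>J. A i j * w j) = 0) \<Longrightarrow> \<forall>j\<in>J. w j = 0"
  shows "\<exists>w. \<forall>i\<in>I. (\<Sum>j\<in>J. A i j * w j) = b i"
  using assms
proof (induction J arbitrary: I A b rule: finite_induct)
  case empty
  then show ?case by simp
next
  case (insert k J)
  have upd: "(\<Sum>j\<in>J. f j * (w(k := y)) j) = (\<Sum>j\<in>J. f j * w j)" for f w y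
    using insert.hyps by (intro sum.cong) auto
  \<comment> \<open>If column \<open>k\<close> were zero, the unit vector at \<open>k\<close> would
    be a nonzero kernel element.\<close>
  have "\<exists>i0\<in>I. A i0 k \<noteq> 0"
  proof (rule ccontr)
    assume "\<not> (\<exists>i0\<in>I. A i0 k \<noteq> 0)"
    then have "(\<Sum>j\<in>insert k J. A i j * ((\<lambda>_. 0)(k := 1)) j) = 0" if "i \<in> I" for i
      unfolding sum.insert[OF insert.hyps] upd using that by simp
    from insert.prems(3)[OF this] show False by simp
  qed
  then obtain i0 where i0: "i0 \<in> I" "A i0 k \<noteq> 0" by blast
  define A' where "A' i j = A i j - A i k * A i0 j / A i0 k" for i j
  have A': "(\<Sum>j\<in>J. A' i j * w j) = (\<Sum>j\<in>J. A i j * w j) - A i k * (\<Sum>j\<in>J. A i0 j * w j) / A i0 k" for i w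
    by (simp add: A'_def sum_subtractf left_diff_distrib sum_distrib_left sum_divide_distrib mult.assoc)
  have "\<exists>w. \<forall>i\<in>I - {i0}. (\<Sum>j\<in>J. A' i j * w j) = b i - A i k * b i0 / A i0 k"
  proof (rule insert.IH)
    show "finite (I - {i0})" "card (I - {i0}) = card J"
      using insert.prems insert.hyps i0 by auto
    fix w assume w: "\<And>i. i \<in> I - {i0} \<Longrightarrow> (\<Sum>j\<in>J. A' i j * w j) = 0"
    \<comment> \<open>The value of unknown \<open>k\<close> forced by the homogeneous pivot row; it
      lifts a kernel vector of the reduced system to one of the full system.\<close>
    define y where "y = - (\<Sum>j\<in>J. A i0 j * w j) / A i0 k"
    have "(\<Sum>j\<in>insert k J. A i j * (w(k := y)) j) = 0" if "i \<in> I" for i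
      unfolding sum.insert[OF insert.hyps] upd
      using w[of i] that i0 by (cases "i = i0") (auto simp: y_def A')
    from insert.prems(3)[OF this] show "\<forall>j\<in>J. w j = 0"
      using insert.hyps by (metis fun_upd_other insertCI)
  qed
  then obtain w where w: "\<And>i. i \<in> I - {i0} \<Longrightarrow> (\<Sum>j\<in>J. A' i j * w j) = b i - A i k * b i0 / A i0 k"
    by blast
  define y where "y = (b i0 - (\<Sum>j\<in>J. A i0 j * w j)) / A i0 k"
  have "(\<Sum>j\<in>insert k J. A i j * (w(k := y)) j) = b i" if "i \<in> I" for i
    unfolding sum.insert[OF insert.hyps] upd
    using w[of i, unfolded A'] that i0
    by (cases "i = i0") (auto simp: y_def diff_divide_distrib right_diff_distrib)
  then show ?case by blast
qed

text \<open>The matrix of \<open>K\<close> has its values on indicator functions as entries. By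
  \<open>cong\<close>, any \<open>w\<close> may be replaced by the combination of indicators that
  agrees with it on \<open>V\<close>.\<close>

lemma linear_operator_surj_if_inj:
  fixes K :: "('v \<Rightarrow> real) \<Rightarrow> 'v \<Rightarrow> real"
  assumes V: "finite V"
    and add: "\<And>f g v. v \<in> V \<Longrightarrow> K (\<lambda>x. f x + g x) v = K f v + K g v"
    and mult: "\<And>c f v. v \<in> V \<Longrightarrow> K (\<lambda>x. c * f x) v = c * K f v"
    and cong: "\<And>f g v. (\<And>x. x \<in> V \<Longrightarrow> f x = g x) \<Longrightarrow> v \<in> V \<Longrightarrow> K f v = K g v"
    and inj: "\<And>w. (\<And>v. v \<in> V \<Longrightarrow> K w v = 0) \<Longrightarrow> \<forall>v\<in>V. w v = 0"
  shows "\<exists>w. \<forall>v\<in>V. K w v = b v"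
proof -
  have sum: "K (\<lambda>x. \<Sum>j\<in>J. w j * of_bool (x = j)) v = (\<Sum>j\<in>J. K (\<lambda>x. of_bool (x = j)) v * w j)"
    if "finite J" "v \<in> V" for J w v
    using that(1)
  proof induction
    case empty
    show ?case using mult[OF that(2), of 0 "\<lambda>_. 0"] by simp
  next
    case (insert j J)
    show ?case
      unfolding sum.insert[OF insert.hyps] add[OF that(2)] mult[OF that(2)] insert.IH by simp
  qed
  have K: "(\<Sum>j\<in>V. K (\<lambda>x. of_bool (x = j)) v * w j) = K w v" if "v \<in> V" for v w
    unfolding sum[OF V that, symmetric] using V that by (intro cong) (simp_all add: sum.delta)
  have "\<exists>w. \<forall>v\<in>V. (\<Sum>j\<in>V. K (\<lambda>x. of_bool (x = j)) v * w j) = b v"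
    by (rule square_system_solvable[OF V V refl]) (use inj K in auto)
  then show ?thesis using K by auto
qed

section \<open>The topology of a metric graph\<close>

lemma edge_point_in_points:
  assumes "metric_graph G" "e \<in> edges G" "x \<in> {0..len G e}"
  shows "edge_point G e x \<in> points G"
  using assms by (auto simp: edge_point_def points_def metric_graph_def)

lemma continuous_map_edge_point:
  assumes "metric_graph G" "e \<in> edges G"
  shows "continuous_map (top_of_set {0..len G e}) (graph_topology G) (edge_point G e)"
  using assms edge_point_in_points[OF assms]
  by (auto simp: continuous_map_def topspace_graph_topology openin_graph_topology)

text \<open>Universal property of the final topology; continuity on the graph becomes one condition
  per edge.\<close>

lemma continuous_map_graph_topology_iff:
  assumes G: "metric_graph G"
  shows "continuous_map (graph_topology G) euclideanreal u \<longleftrightarrow>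
    (\<forall>e\<in>edges G. continuous_on {0..len G e} (restr G u e))"
proof
  assume u: "continuous_map (graph_topology G) euclideanreal u"
  show "\<forall>e\<in>edges G. continuous_on {0..len G e} (restr G u e)"
  proof
    fix e assume "e \<in> edges G"
    from continuous_map_compose[OF continuous_map_edge_point[OF G this] u]
    show "continuous_on {0..len G e} (restr G u e)"
      by (simp add: o_def restr_def[abs_def])
  qed
next
  assume u: "\<forall>e\<in>edges G. continuous_on {0..len G e} (restr G u e)"
  have "openin (graph_topology G) {p \<in> points G. u p \<in> S}" if "open S" for S
    unfolding openin_graph_topology
  proof (intro conjI ballI)
    fix e assume e: "e \<in> edges G"
    have "{x \<in> {0..len G e}. edge_point G e x \<in> {p \<in> points G. u p \<in> S}} =
        {0..len G e} \<inter> restr G u e -` S"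
      using edge_point_in_points[OF G e] by (auto simp: restr_def)
    then show "openin (top_of_set {0..len G e})
        {x \<in> {0..len G e}. edge_point G e x \<in> {p \<in> points G. u p \<in> S}}"
      using continuous_openin_preimage_gen[OF bspec[OF u e] that] by simp
  qed auto
  then show "continuous_map (graph_topology G) euclideanreal u"
    by (simp add: continuous_map_def topspace_graph_topology[OF G])
qed

text \<open>In contrast to \<^const>\<open>connected_graph\<close>, this notion does not involve the edge lengths, hence is
  trivially invariant under scaling.\<close>

definition combinatorially_connected :: "('v, 'e) mgraph \<Rightarrow> bool" where
  "combinatorially_connected G \<longleftrightarrow> (\<forall>w :: 'v \<Rightarrow> real.
     (\<forall>e\<in>edges G. w (src G e) = w (tgt G e)) \<longrightarrow> (\<forall>v\<in>verts G. \<forall>v'\<in>verts G. w v = w v'))"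

text \<open>A vertex function that agrees at the two ends of every edge extends to the graph as a
  function constant on each edge. All its level sets are open, so on a connected space it is
  constant.\<close>

lemma connected_graph_imp_combinatorially_connected:
  assumes G: "metric_graph G" and "connected_graph G"
  shows "combinatorially_connected G"
  unfolding combinatorially_connected_def
proof (intro allI impI ballI)
  fix w :: "'a \<Rightarrow> real" and v v'
  assume w: "\<forall>e\<in>edges G. w (src G e) = w (tgt G e)" and v: "v \<in> verts G" "v' \<in> verts G"
  define F where "F p = (case p of Vertex v \<Rightarrow> w v | Interior e x \<Rightarrow> w (src G e))" for p :: "('a, 'b) gpoint"
  have F: "F (edge_point G e x) = w (src G e)" if "e \<in> edges G" for e x
    using w that by (auto simp: F_def edge_point_def)
  \<comment> \<open>With \<open>P\<close> arbitrary, this covers both a level set and its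
    complement.\<close>
  have op: "openin (graph_topology G) {p \<in> points G. P (F p)}" for P
    unfolding openin_graph_topology
  proof (intro conjI ballI)
    fix e assume e: "e \<in> edges G"
    have "{x \<in> {0..len G e}. edge_point G e x \<in> {p \<in> points G. P (F p)}} =
        (if P (w (src G e)) then {0..len G e} else {})"
      by (auto simp: F[OF e] edge_point_in_points[OF G e])
    then show "openin (top_of_set {0..len G e})
        {x \<in> {0..len G e}. edge_point G e x \<in> {p \<in> points G. P (F p)}}"
      by simp
  qed auto
  show "w v = w v'"
  proof (rule ccontr)
    assume ne: "w v \<noteq> w v'"
    have "connected_space (graph_topology G)"
      using assms(2) by (simp add: connected_graph_def path_connected_imp_connected_space)
    moreover have "Vertex v \<in> {p \<in> points G. F p = w v}" "Vertex v' \<in> {p \<in> points G. F p \<noteq> w v}"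
      using v ne by (auto simp: points_def F_def)
    moreover have "topspace (graph_topology G) \<subseteq> {p \<in> points G. F p = w v} \<union> {p \<in> points G. F p \<noteq> w v}"
      using topspace_graph_topology[OF G] by auto
    moreover have "{p \<in> points G. F p = w v} \<inter> {p \<in> points G. F p \<noteq> w v} = {}" by auto
    ultimately show False
      using op[of "\<lambda>y. y = w v"] op[of "\<lambda>y. y \<noteq> w v"]
      unfolding connected_space_def by (metis (no_types, lifting) empty_iff)
  qed
qed

section \<open>The linear system for the vertex values\<close>

text \<open>On an edge of length \<open>l\<close>, the solution of \<open>- u'' = 1\<close> with boundary values \<open>y\<close>, \<open>z\<close> has derivatives
  \<open>(z - y) / l + l / 2\<close> at \<open>0\<close> and \<open>(z - y) / l - l / 2\<close> at \<open>l\<close>. The vertex conditions therefore become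
  \<open>vertex_operator G \<alpha> w = vertex_load G\<close> for the vector \<open>w\<close> of vertex values.\<close>

definition vertex_operator :: "('v, 'e) mgraph \<Rightarrow> ('v \<Rightarrow> real) \<Rightarrow> ('v \<Rightarrow> real) \<Rightarrow> 'v \<Rightarrow> real" where
  "vertex_operator G \<alpha> w v =
     (\<Sum>e | e \<in> edges G \<and> src G e = v. - ((w (tgt G e) - w (src G e)) / len G e)) +
     (\<Sum>e | e \<in> edges G \<and> tgt G e = v. (w (tgt G e) - w (src G e)) / len G e) + \<alpha> v * w v"

definition vertex_load :: "('v, 'e) mgraph \<Rightarrow> 'v \<Rightarrow> real" where
  "vertex_load G v =
     (\<Sum>e | e \<in> edges G \<and> src G e = v. len G e / 2) + (\<Sum>e | e \<in> edges G \<and> tgt G e = v. len G e / 2)"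

text \<open>Discrete Green identity: regrouping the vertex sums by edges, each edge contributes once
  at its source and once at its target, and the two contributions combine to a square.\<close>

lemma sum_vertex_operator:
  assumes G: "metric_graph G"
  shows "(\<Sum>v\<in>verts G. w v * vertex_operator G \<alpha> w v) =
    (\<Sum>e\<in>edges G. (w (tgt G e) - w (src G e))\<^sup>2 / len G e) + (\<Sum>v\<in>verts G. \<alpha> v * (w v)\<^sup>2)"
proof -
  define D where "D e = (w (tgt G e) - w (src G e)) / len G e" for e
  have *: "(\<Sum>v\<in>verts G. w v * (\<Sum>e | e \<in> edges G \<and> s e = v. f e)) = (\<Sum>e\<in>edges G. w (s e) * f e)"
    if "s ` edges G \<subseteq> verts G" for s and f :: "_ \<Rightarrow> real"
  proof -
    have "(\<Sum>v\<in>verts G. w v * (\<Sum>e | e \<in> edges G \<and> s e = v. f e)) =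
        (\<Sum>v\<in>verts G. \<Sum>e | e \<in> edges G \<and> s e = v. w (s e) * f e)"
      by (simp add: sum_distrib_left)
    also have "\<dots> = (\<Sum>e\<in>edges G. w (s e) * f e)"
      using G that by (intro sum.group) (auto simp: metric_graph_def)
    finally show ?thesis .
  qed
  have "(\<Sum>v\<in>verts G. w v * vertex_operator G \<alpha> w v) =
      (\<Sum>v\<in>verts G. w v * (\<Sum>e | e \<in> edges G \<and> src G e = v. - D e)) +
      (\<Sum>v\<in>verts G. w v * (\<Sum>e | e \<in> edges G \<and> tgt G e = v. D e)) +
      (\<Sum>v\<in>verts G. w v * (\<alpha> v * w v))"
    by (simp add: vertex_operator_def D_def ring_distribs sum.distrib)
  also have "\<dots> = (\<Sum>e\<in>edges G. w (src G e) * - D e) + (\<Sum>e\<in>edges G. w (tgt G e) * D e) +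
      (\<Sum>v\<in>verts G. w v * (\<alpha> v * w v))"
    using G by (subst (1 2) *) (auto simp: metric_graph_def)
  also have "\<dots> = (\<Sum>e\<in>edges G. (w (tgt G e) - w (src G e))\<^sup>2 / len G e) + (\<Sum>v\<in>verts G. \<alpha> v * (w v)\<^sup>2)"
    by (simp add: D_def sum.distrib[symmetric] algebra_simps power2_eq_square diff_divide_distrib add_divide_distrib)
  finally show ?thesis .
qed

text \<open>A kernel vector has zero energy. The edge terms make it constant along edges, hence
  constant by connectedness, and a vertex with positive strength makes the constant zero.\<close>

lemma vertex_operator_inj:
  assumes G: "metric_graph G" "combinatorially_connected G"
    and nonneg: "\<forall>v\<in>verts G. 0 \<le> \<alpha> v" and nz: "\<exists>v\<in>verts G. \<alpha> v \<noteq> 0"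
    and w: "\<And>v. v \<in> verts G \<Longrightarrow> vertex_operator G \<alpha> w v = 0"
  shows "\<forall>v\<in>verts G. w v = 0"
proof -
  have fin: "finite (verts G)" "finite (edges G)" and len: "\<And>e. e \<in> edges G \<Longrightarrow> 0 < len G e"
    using G by (auto simp: metric_graph_def)
  let ?E = "\<lambda>e. (w (tgt G e) - w (src G e))\<^sup>2 / len G e" and ?A = "\<lambda>v. \<alpha> v * (w v)\<^sup>2"
  have E: "?E e \<ge> 0" if "e \<in> edges G" for e using len[OF that] by simp
  have A: "?A v \<ge> 0" if "v \<in> verts G" for v using nonneg that by simp
  have "sum ?E (edges G) + sum ?A (verts G) = 0"
    using sum_vertex_operator[OF G(1), of w \<alpha>] w by simp
  then have "sum ?E (edges G) = 0" "sum ?A (verts G) = 0"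
    using sum_nonneg[of "edges G" ?E] sum_nonneg[of "verts G" ?A] E A by fastforce+
  then have E0: "\<And>e. e \<in> edges G \<Longrightarrow> ?E e = 0" and A0: "\<And>v. v \<in> verts G \<Longrightarrow> ?A v = 0"
    using fin E A by (simp_all add: sum_nonneg_eq_0_iff)
  have "w (src G e) = w (tgt G e)" if "e \<in> edges G" for e
    using E0[OF that] len[OF that] by simp
  then have const: "\<forall>v\<in>verts G. \<forall>v'\<in>verts G. w v = w v'"
    using G(2) unfolding combinatorially_connected_def by blast
  obtain v0 where "v0 \<in> verts G" "\<alpha> v0 \<noteq> 0" using nz by blast
  then have "w v0 = 0" using A0[of v0] by simp
  moreover have "\<forall>v\<in>verts G. w v = w v0" using const \<open>v0 \<in> verts G\<close> by blast
  ultimately show ?thesis by simp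
qed

lemma vertex_operator_diff:
  "vertex_operator G \<alpha> (\<lambda>x. f x - g x) v = vertex_operator G \<alpha> f v - vertex_operator G \<alpha> g v"
  unfolding vertex_operator_def
  by (simp add: sum_subtractf[symmetric] sum_negf[symmetric] sum.distrib[symmetric]
      algebra_simps diff_divide_distrib add_divide_distrib)

lemma vertex_operator_surj:
  assumes G: "metric_graph G" "combinatorially_connected G"
    and "\<forall>v\<in>verts G. 0 \<le> \<alpha> v" "\<exists>v\<in>verts G. \<alpha> v \<noteq> 0"
  shows "\<exists>w. \<forall>v\<in>verts G. vertex_operator G \<alpha> w v = b v"
proof (rule linear_operator_surj_if_inj)
  show "finite (verts G)" using G by (simp add: metric_graph_def)
  show mult: "vertex_operator G \<alpha> (\<lambda>x. c * f x) v = c * vertex_operator G \<alpha> f v" for c f v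
    unfolding vertex_operator_def distrib_left sum_distrib_left
    by (intro arg_cong2[of _ _ _ _ "(+)"] sum.cong refl)
       (simp_all add: right_diff_distrib diff_divide_distrib)
  \<comment> \<open>Additivity comes from the difference rule, writing f + g as f - (-1) g.\<close>
  show "vertex_operator G \<alpha> (\<lambda>x. f x + g x) v = vertex_operator G \<alpha> f v + vertex_operator G \<alpha> g v" for f g v
    using vertex_operator_diff[of G \<alpha> f "\<lambda>x. - 1 * g x" v] mult[of "-1" g v] by simp
  show "vertex_operator G \<alpha> f v = vertex_operator G \<alpha> g v"
    if "\<And>x. x \<in> verts G \<Longrightarrow> f x = g x" "v \<in> verts G" for f g v
  proof -
    have "f (src G e) = g (src G e)" "f (tgt G e) = g (tgt G e)" if "e \<in> edges G" for e
      using G(1) that \<open>\<And>x. x \<in> verts G \<Longrightarrow> f x = g x\<close> by (auto simp: metric_graph_def)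
    then show ?thesis using that(1)[OF that(2)] unfolding vertex_operator_def
      by (intro arg_cong2[of _ _ _ _ "(+)"] sum.cong) auto
  qed
qed (rule vertex_operator_inj[OF assms])

section \<open>The torsion function\<close>

text \<open>The solution of -u'' = 1 on \<open>{0..l}\<close> with values \<open>y\<close> at 0 and
  \<open>z\<close> at \<open>l\<close>: linear interpolation plus the solution with zero boundary
  values.\<close>

definition parabola :: "real \<Rightarrow> real \<Rightarrow> real \<Rightarrow> real \<Rightarrow> real" where
  "parabola l y z x = y * (1 - x / l) + z * (x / l) + x * (l - x) / 2"

lemma has_real_derivative_parabola:
  assumes "l > 0"
  shows "(parabola l y z has_real_derivative (z - y) / l + (l - 2 * x) / 2) (at x within S)"
  unfolding parabola_def[abs_def] using assms
  by (auto intro!: derivative_eq_intros simp: field_simps)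

lemma integral_parabola:
  assumes "l > 0"
  shows "integral {0..l} (parabola l y z) = l * (y + z) / 2 + l ^ 3 / 12"
proof -
  let ?F = "\<lambda>x. y * (x - x ^ 2 / (2 * l)) + z * (x ^ 2 / (2 * l)) + l * x ^ 2 / 4 - x ^ 3 / 6"
  have "(parabola l y z has_integral ?F l - ?F 0) {0..l}"
  proof (rule fundamental_theorem_of_calculus)
    fix x
    have "(?F has_real_derivative parabola l y z x) (at x within {0..l})"
      unfolding parabola_def using assms
      by (auto intro!: derivative_eq_intros simp: field_simps power2_eq_square)
    then show "(?F has_vector_derivative parabola l y z x) (at x within {0..l})"
      by (simp add: has_real_derivative_iff_has_vector_derivative)
  qed (use assms in simp)
  then have "integral {0..l} (parabola l y z) = ?F l - ?F 0" by (rule integral_unique)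
  also have "\<dots> = l * (y + z) / 2 + l ^ 3 / 12"
    using assms by (simp add: field_simps power2_eq_square power3_eq_cube)
  finally show ?thesis .
qed

text \<open>The restriction to \<open>points G\<close> makes the function extensional, as
  \<open>laplacian_domain\<close> demands, so that uniqueness holds as equality in HOL.\<close>

definition edgewise_parabolic :: "('v, 'e) mgraph \<Rightarrow> ('v \<Rightarrow> real) \<Rightarrow> ('v, 'e) gpoint \<Rightarrow> real" where
  "edgewise_parabolic G w = restrict (\<lambda>p. case p of
     Vertex v \<Rightarrow> w v
   | Interior e x \<Rightarrow> parabola (len G e) (w (src G e)) (w (tgt G e)) x) (points G)"

lemma restr_edgewise_parabolic:
  assumes G: "metric_graph G" "e \<in> edges G" and x: "x \<in> {0..len G e}"
  shows "restr G (edgewise_parabolic G w) e x = parabola (len G e) (w (src G e)) (w (tgt G e)) x"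
proof -
  have "0 < len G e" using G by (simp add: metric_graph_def)
  then show ?thesis
    using edge_point_in_points[OF G x]
    by (simp add: restr_def edgewise_parabolic_def) (auto simp: edge_point_def parabola_def)
qed

lemma edgewise_parabolic_Vertex:
  "v \<in> verts G \<Longrightarrow> edgewise_parabolic G w (Vertex v) = w v"
  by (simp add: edgewise_parabolic_def points_def)

text \<open>The linear system fixes \<open>w\<close> on \<open>verts G\<close> only; this turns that
  agreement into equality of the functions on the graph.\<close>

lemma edgewise_parabolic_cong:
  assumes "metric_graph G" "\<And>v. v \<in> verts G \<Longrightarrow> w v = w' v"
  shows "edgewise_parabolic G w = edgewise_parabolic G w'"
  unfolding edgewise_parabolic_def
  using assms by (intro restrict_ext) (auto simp: points_def metric_graph_def)

lemma has_real_derivative_restr_edgewise_parabolic: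
  assumes G: "metric_graph G" "e \<in> edges G" and x: "x \<in> {0..len G e}"
  shows "(restr G (edgewise_parabolic G w) e has_real_derivative
    (w (tgt G e) - w (src G e)) / len G e + (len G e - 2 * x) / 2) (at x within {0..len G e})"
  unfolding has_real_derivative_iff_has_vector_derivative
proof (rule has_vector_derivative_transform[OF x])
  show "(parabola (len G e) (w (src G e)) (w (tgt G e)) has_vector_derivative
      (w (tgt G e) - w (src G e)) / len G e + (len G e - 2 * x) / 2) (at x within {0..len G e})"
    unfolding has_real_derivative_iff_has_vector_derivative[symmetric]
    using G by (intro has_real_derivative_parabola) (simp add: metric_graph_def)
qed (rule restr_edgewise_parabolic[OF G])

lemma continuous_on_restr_edgewise_parabolic:
  assumes "metric_graph G" "e \<in> edges G"
  shows "continuous_on {0..len G e} (restr G (edgewise_parabolic G w) e)"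
  using has_real_derivative_restr_edgewise_parabolic[OF assms]
  by (meson DERIV_continuous continuous_on_eq_continuous_within)

lemma normal_derivative_sum_edgewise_parabolic:
  assumes G: "metric_graph G"
  shows "normal_derivative_sum G (edgewise_parabolic G w) v + \<alpha> v * w v =
    vertex_operator G \<alpha> w v - vertex_load G v"
proof -
  have vd: "vector_derivative (restr G (edgewise_parabolic G w) e) (at x within {0..len G e}) =
      (w (tgt G e) - w (src G e)) / len G e + (len G e - 2 * x) / 2"
    if "e \<in> edges G" "x \<in> {0..len G e}" for e x
    using G that has_real_derivative_restr_edgewise_parabolic[OF G that]
    by (intro vector_derivative_within_closed_interval)
       (auto simp: metric_graph_def has_real_derivative_iff_has_vector_derivative)
  have len: "0 \<le> len G e" if "e \<in> edges G" for e
    using G that by (simp add: metric_graph_def less_imp_le)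
  have "normal_derivative_sum G (edgewise_parabolic G w) v =
     (\<Sum>e | e \<in> edges G \<and> src G e = v. - ((w (tgt G e) - w (src G e)) / len G e) - len G e / 2) +
     (\<Sum>e | e \<in> edges G \<and> tgt G e = v. (w (tgt G e) - w (src G e)) / len G e - len G e / 2)"
    unfolding normal_derivative_sum_def
    by (intro arg_cong2[of _ _ _ _ "(+)"] sum.cong refl) (simp_all add: vd len)
  then show ?thesis
    by (simp add: vertex_operator_def vertex_load_def sum_subtractf)
qed

lemma second_weak_derivative_edgewise_parabolic:
  assumes G: "metric_graph G" "e \<in> edges G"
  shows "second_weak_derivative 0 (len G e) (restr G (edgewise_parabolic G w) e) (\<lambda>_. - 1)"
  unfolding second_weak_derivative_def
proof (intro bexI conjI)
  let ?g = "\<lambda>x. (w (tgt G e) - w (src G e)) / len G e + (len G e - 2 * x) / 2"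
  have len: "0 \<le> len G e" using G by (simp add: metric_graph_def less_imp_le)
  have cont: "continuous_on {0..len G e} ?g" by (intro continuous_intros) simp
  show "weak_derivative 0 (len G e) (restr G (edgewise_parabolic G w) e) ?g"
    by (rule weak_derivative_C1[OF has_real_derivative_restr_edgewise_parabolic[OF G] cont len])
  show "weak_derivative 0 (len G e) ?g (\<lambda>_. - 1)"
    by (rule weak_derivative_C1) (auto intro!: derivative_eq_intros simp: len)
  show "?g \<in> L2 0 (len G e)" by (rule L2_continuous[OF cont])
qed

section \<open>Reduction of the torsion problem to the vertex system\<close>

lemma edge_point_simps:
  assumes "metric_graph G" "e \<in> edges G"
  shows "edge_point G e 0 = Vertex (src G e)" "edge_point G e (len G e) = Vertex (tgt G e)"
    "0 < x \<Longrightarrow> x < len G e \<Longrightarrow> edge_point G e x = Interior e x"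
  using assms by (auto simp: edge_point_def metric_graph_def)

lemma restr_const: "restr G (\<lambda>_. c) e = (\<lambda>_. c)"
  by (simp add: restr_def[abs_def])

text \<open>A solution is the parabola with its own end values on each edge by
  \<open>second_weak_derivative_minus_1\<close>, and then the vertex conditions are exactly the
  linear system. Conversely, parabolas are smooth up to the end points, so the remaining domain
  conditions hold directly.\<close>

lemma neg_laplacian_1_iff:
  assumes G: "metric_graph G"
  shows "neg_laplacian G \<alpha> u (\<lambda>_. 1) \<longleftrightarrow>
    (\<exists>w. (\<forall>v\<in>verts G. vertex_operator G \<alpha> w v = vertex_load G v) \<and> u = edgewise_parabolic G w)"
proof
  assume u: "neg_laplacian G \<alpha> u (\<lambda>_. 1)"
  define w where "w v = u (Vertex v)" for v
  have ext: "u \<in> extensional (points G)"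
    and cont: "\<And>e. e \<in> edges G \<Longrightarrow> continuous_on {0..len G e} (restr G u e)"
    and ndv: "\<And>v. v \<in> verts G \<Longrightarrow> normal_derivative_sum G u v + \<alpha> v * w v = 0"
    and weak: "\<And>e. e \<in> edges G \<Longrightarrow> second_weak_derivative 0 (len G e) (restr G u e) (\<lambda>_. - 1)"
    using u by (auto simp: neg_laplacian_def laplacian_domain_def w_def restr_const
        continuous_map_graph_topology_iff[OF G])
  have "u = edgewise_parabolic G w"
  proof (rule extensionalityI[OF ext])
    show "edgewise_parabolic G w \<in> extensional (points G)"
      by (simp add: edgewise_parabolic_def)
    fix p assume p: "p \<in> points G"
    show "u p = edgewise_parabolic G w p"
    proof (cases p)
      case (Vertex v)
      then show ?thesis using p by (auto simp: edgewise_parabolic_def w_def)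
    next
      case (Interior e x)
      then have e: "e \<in> edges G" and x: "0 < x" "x < len G e" using p by (auto simp: points_def)
      note ep = edge_point_simps[OF G e]
      have "u p = restr G u e x" using Interior ep(3)[OF x] by (simp add: restr_def)
      also have "\<dots> = parabola (len G e) (w (src G e)) (w (tgt G e)) x"
        using second_weak_derivative_minus_1[OF cont[OF e] weak[OF e], of x] x
        by (simp add: parabola_def restr_def ep w_def)
      finally show ?thesis using p Interior by (simp add: edgewise_parabolic_def)
    qed
  qed
  moreover from this have "\<forall>v\<in>verts G. vertex_operator G \<alpha> w v = vertex_load G v"
    using ndv normal_derivative_sum_edgewise_parabolic[OF G, of w _ \<alpha>] by simp
  ultimately show "\<exists>w. (\<forall>v\<in>verts G. vertex_operator G \<alpha> w v = vertex_load G v) \<and>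
      u = edgewise_parabolic G w" by blast
next
  assume "\<exists>w. (\<forall>v\<in>verts G. vertex_operator G \<alpha> w v = vertex_load G v) \<and> u = edgewise_parabolic G w"
  then obtain w where w: "\<And>v. v \<in> verts G \<Longrightarrow> vertex_operator G \<alpha> w v = vertex_load G v"
    and u: "u = edgewise_parabolic G w" by blast
  have L2: "(\<lambda>_. c) \<in> L2 a b" for a b c :: real by (intro L2_continuous continuous_intros)
  have "u \<in> laplacian_domain G \<alpha>"
    unfolding laplacian_domain_def
  proof (intro CollectI conjI ballI)
    show "u \<in> extensional (points G)" by (simp add: u edgewise_parabolic_def)
    show "restr G u e \<in> H2 0 (len G e)" if "e \<in> edges G" for e
      unfolding H2_def u using L2[of "- 1" 0 "len G e"] second_weak_derivative_edgewise_parabolic[OF G that]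
        L2_continuous[OF continuous_on_restr_edgewise_parabolic[OF G that]] by blast
    show "continuous_map (graph_topology G) euclideanreal u"
      unfolding continuous_map_graph_topology_iff[OF G] u
      using continuous_on_restr_edgewise_parabolic[OF G] by blast
    show "normal_derivative_sum G u v + \<alpha> v * u (Vertex v) = 0" if "v \<in> verts G" for v
      using normal_derivative_sum_edgewise_parabolic[OF G, of w v \<alpha>] w[OF that]
      by (simp add: u edgewise_parabolic_Vertex[OF that])
  qed
  then show "neg_laplacian G \<alpha> u (\<lambda>_. 1)"
    using second_weak_derivative_edgewise_parabolic[OF G] L2
    by (simp add: neg_laplacian_def restr_const u)
qed

text \<open>Two solutions of the system differ by a kernel vector of \<open>vertex_operator\<close>,
  which vanishes on \<open>verts G\<close>; this is the uniqueness behind the definite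
  description.\<close>

lemma torsion_function_eq:
  assumes G: "metric_graph G" "combinatorially_connected G"
    and \<alpha>: "\<forall>v\<in>verts G. 0 \<le> \<alpha> v" "\<exists>v\<in>verts G. \<alpha> v \<noteq> 0"
    and w: "\<forall>v\<in>verts G. vertex_operator G \<alpha> w v = vertex_load G v"
  shows "torsion_function G \<alpha> = edgewise_parabolic G w"
  unfolding torsion_function_def
proof (rule the_equality)
  show "neg_laplacian G \<alpha> (edgewise_parabolic G w) (\<lambda>_. 1)"
    using w by (auto simp: neg_laplacian_1_iff[OF G(1)])
  fix u assume "neg_laplacian G \<alpha> u (\<lambda>_. 1)"
  then obtain w' where w': "\<forall>v\<in>verts G. vertex_operator G \<alpha> w' v = vertex_load G v"
    and u: "u = edgewise_parabolic G w'" by (auto simp: neg_laplacian_1_iff[OF G(1)])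
  have "\<forall>v\<in>verts G. w' v - w v = 0"
    by (rule vertex_operator_inj[OF G \<alpha>]) (simp add: vertex_operator_diff w w')
  then show "u = edgewise_parabolic G w"
    unfolding u by (intro edgewise_parabolic_cong[OF G(1)]) simp
qed

lemma torsional_rigidity_eq:
  assumes G: "metric_graph G" "combinatorially_connected G"
    and \<alpha>: "\<forall>v\<in>verts G. 0 \<le> \<alpha> v" "\<exists>v\<in>verts G. \<alpha> v \<noteq> 0"
    and w: "\<forall>v\<in>verts G. vertex_operator G \<alpha> w v = vertex_load G v"
  shows "torsional_rigidity G \<alpha> =
    (\<Sum>e\<in>edges G. len G e * (w (src G e) + w (tgt G e)) / 2 + len G e ^ 3 / 12)"
  unfolding torsional_rigidity_def torsion_function_eq[OF assms]
proof (rule sum.cong)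
  fix e assume e: "e \<in> edges G"
  let ?f = "restr G (edgewise_parabolic G w) e"
  have len: "0 < len G e" using G(1) e by (simp add: metric_graph_def)
  have "(LINT x|lebesgue_on {0..len G e}. ?f x) = integral {0..len G e} ?f"
    by (rule lebesgue_integral_eq_integral)
       (auto intro!: continuous_imp_integrable_real continuous_on_restr_edgewise_parabolic[OF G(1) e])
  also have "\<dots> = integral {0..len G e} (parabola (len G e) (w (src G e)) (w (tgt G e)))"
    by (rule integral_cong) (rule restr_edgewise_parabolic[OF G(1) e])
  finally show "(LINT x|lebesgue_on {0..len G e}. ?f x) =
      len G e * (w (src G e) + w (tgt G e)) / 2 + len G e ^ 3 / 12"
    by (simp add: integral_parabola[OF len])
qed simp

section \<open>Scaling of the vertex system\<close>

lemma vertex_operator_scale_graph: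
  assumes "t > 0"
  shows "vertex_operator (scale_graph t G) (\<lambda>v. (1 / t) * \<alpha> v) (\<lambda>v. t\<^sup>2 * w v) v =
    t * vertex_operator G \<alpha> w v"
proof -
  \<comment> \<open>Differences of vertex values gain t^2 and lengths gain t, so slopes gain t; the
    strength term also gains t^2 / t.\<close>
  have *: "(t\<^sup>2 * y - t\<^sup>2 * z) / (t * l) = t * ((y - z) / l)" for y z l
    using assms by (simp add: power2_eq_square mult.assoc right_diff_distrib[symmetric])
  have "1 / t * \<alpha> v * (t\<^sup>2 * w v) = t * (\<alpha> v * w v)"
    using assms by (simp add: power2_eq_square)
  then show ?thesis
    by (simp add: vertex_operator_def scale_graph_def * distrib_left sum_distrib_left)
qed

text \<open>The factor matches the one in \<open>vertex_operator_scale_graph\<close>, so t^2 times a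
  solution for \<open>G\<close> solves the scaled system.\<close>

lemma vertex_load_scale_graph: "vertex_load (scale_graph t G) v = t * vertex_load G v"
  by (simp add: vertex_load_def scale_graph_def distrib_left sum_distrib_left)

theorem theorem7p2:
  fixes G :: "('v, 'e) mgraph" and \<alpha> :: "'v \<Rightarrow> real" and t :: real
  assumes "metric_graph G"
    and "connected_graph G"
    and "\<forall>v\<in>verts G. 0 \<le> \<alpha> v"
    and "\<exists>v\<in>verts G. \<alpha> v \<noteq> 0"
    and "t > 0"
  shows "t powi (-3) * torsional_rigidity (scale_graph t G) (\<lambda>v. (1 / t) * \<alpha> v)
           = torsional_rigidity G \<alpha>"
proof -
  have conn: "combinatorially_connected G"
    by (rule connected_graph_imp_combinatorially_connected[OF assms(1,2)])
  obtain w where w: "\<forall>v\<in>verts G. vertex_operator G \<alpha> w v = vertex_load G v"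
    using vertex_operator_surj[OF assms(1) conn assms(3,4)] by blast
  have "torsional_rigidity (scale_graph t G) (\<lambda>v. (1 / t) * \<alpha> v) =
    (\<Sum>e\<in>edges (scale_graph t G). len (scale_graph t G) e *
       (t\<^sup>2 * w (src (scale_graph t G) e) + t\<^sup>2 * w (tgt (scale_graph t G) e)) / 2 +
       len (scale_graph t G) e ^ 3 / 12)"
  proof (rule torsional_rigidity_eq)
    show "metric_graph (scale_graph t G)" "combinatorially_connected (scale_graph t G)"
      using assms conn by (simp_all add: metric_graph_def combinatorially_connected_def scale_graph_def)
    show "\<forall>v\<in>verts (scale_graph t G). 0 \<le> 1 / t * \<alpha> v" "\<exists>v\<in>verts (scale_graph t G). 1 / t * \<alpha> v \<noteq> 0"
      using assms by (simp_all add: scale_graph_def)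
    show "\<forall>v\<in>verts (scale_graph t G). vertex_operator (scale_graph t G) (\<lambda>v. 1 / t * \<alpha> v) (\<lambda>v. t\<^sup>2 * w v) v =
        vertex_load (scale_graph t G) v"
      using w vertex_operator_scale_graph[OF assms(5), of G \<alpha> w] vertex_load_scale_graph[of t G]
      by (simp add: scale_graph_def)
  qed
  \<comment> \<open>Both summands are cubic in the scale: length times vertex values gives t * t^2,
    and the cubed length gives t^3.\<close>
  also have "\<dots> = (\<Sum>e\<in>edges G. t ^ 3 * (len G e * (w (src G e) + w (tgt G e)) / 2 + len G e ^ 3 / 12))"
    by (simp add: scale_graph_def) (intro sum.cong; simp add: power2_eq_square power3_eq_cube algebra_simps)
  also have "\<dots> = t ^ 3 * torsional_rigidity G \<alpha>"
    by (simp add: torsional_rigidity_eq[OF assms(1) conn assms(3,4) w] sum_distrib_left)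
  finally show ?thesis using assms(5) by (simp add: power_int_minus)
qed

end
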